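(* Let $\mathcal L(\lambda)=\begin{bmatrix}M(\lambda)&K_2(\lambda)^T\\ K_1(\lambda)&0\end{bmatrix}$ be a strong block minimal bases degree-$\ell$ matrix polynomial, let $N_1(\lambda)$ be a minimal basis dual to $K_1(\lambda)$, let $N_2(\lambda)$ be a minimal basis dual to $K_2(\lambda)$, and let $Q(\lambda):=N_2(\lambda)M(\lambda)N_1(\lambda)^T$. For $i=1,2$ let $$U_i(\lambda)=\begin{bmatrix}K_i(\lambda)\\ \widehat K_i(\lambda)\end{bmatrix}\quad\text{be unimodular with}\quad U_i(\lambda)^{-1}=\begin{bmatrix}\widehat N_i(\lambda)^T&N_i(\lambda)^T\end{bmatrix}.$$ Then the following right- and left-sided factorizations hold: $$\mathcal L(\lambda)\begin{bmatrix}N_1(\lambda)^T\\ -\widehat N_2(\lambda)M(\lambda)N_1(\lambda)^T\end{bmatrix}=\begin{bmatrix}\widehat K_2(\lambda)^T\\ 0\end{bmatrix}Q(\lambda),$$ and $$\begin{bmatrix}N_2(\lambda)&-N_2(\lambda)M(\lambda)\widehat N_1(\lambda)^T\end{bmatrix}\mathcal L(\lambda)=Q(\lambda)\begin{bmatrix}\widehat K_1(\lambda)&0\end{bmatrix}.$$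
   Context: $\mathbb F$ is an arbitrary field; all matrix polynomials have coefficients in $\mathbb F$. A matrix polynomial has grade $g$ if it can be written $\sum_{i=0}^gP_i\lambda^i$ (coefficients possibly zero). A square matrix polynomial is unimodular if its determinant is a nonzero constant. A minimal basis of a subspace of $\mathbb F(\lambda)^q$ is a basis of vector polynomials whose sum of degrees is least among all bases of vector polynomials. A $p\times q$ matrix polynomial ($p<q$) is called a minimal basis if its rows form a minimal basis of the rational subspace they span. Row degrees are the degrees of the rows. $K(\lambda)\in\mathbb F[\lambda]^{p_1\times q}$ and $N(\lambda)\in\mathbb F[\lambda]^{p_2\times q}$ are dual minimal bases (each is a minimal basis dual to the other) if $p_1+p_2=q$, $K(\lambda)N(\lambda)^T=0$, and both are minimal bases. Strong block minimal bases degree-$\ell$ matrix polynomial ($\ell>0$): $\mathcal L(\lambda)$ as displayed with $M(\lambda)$ of size $(m+m_2)\times(n+m_1)$ and grade $\ell$, $K_1(\lambda)\in\mathbb F[\lambda]^{m_1\times(n+m_1)}$ and $K_2(\lambda)\in\mathbb F[\lambda]^{m_2\times(m+m_2)}$ minimal bases with all row degrees equal to $\ell$, such that the row degrees of a minimal basis dual to $K_1(\lambda)$ are all equal, and the row degrees of a minimal basis dual to $K_2(\lambda)$ are all equal. Degenerate cases where exactly one of $K_1,K_2$ is absent ($m_1=0$ or $m_2=0$) are allowed; then for the absent index $N_i=\widehat K_i=I$ and $\widehat N_i$ is empty. For a pair of dual minimal bases $(K_i,N_i)$, unimodular matrices $U_i$ as in the claim always exist. *)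

theory Defs
  imports
    "HOL-Computational_Algebra.Polynomial_Factorial"
    "Jordan_Normal_Form.Determinant"
    "Jordan_Normal_Form.VS_Connect"
begin

text \<open>Matrix polynomials over a field are matrices of type \<open>'a poly mat\<close>, and the field of rational
  functions is the fraction field \<open>'a poly fract\<close>. Matrices without rows or without columns are
  used for absent blocks.\<close>

definition append_cols :: "'a :: zero mat \<Rightarrow> 'a mat \<Rightarrow> 'a mat" (infixr "@\<^sub>c" 65) where
  "A @\<^sub>c B = four_block_mat A B (0\<^sub>m 0 (dim_col A)) (0\<^sub>m 0 (dim_col B))"

definition has_grade :: "nat \<Rightarrow> 'a :: comm_ring_1 poly mat \<Rightarrow> bool" where
  "has_grade g P \<longleftrightarrow> (\<exists>C :: nat \<Rightarrow> 'a mat.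
     (\<forall>k\<le>g. C k \<in> carrier_mat (dim_row P) (dim_col P)) \<and>
     P = mat (dim_row P) (dim_col P) (\<lambda>(i, j). \<Sum>k\<le>g. monom (C k $$ (i, j)) k))"

definition unimodular :: "'a :: field poly mat \<Rightarrow> bool" where
  "unimodular U \<longleftrightarrow> square_mat U \<and> (\<exists>c. c \<noteq> 0 \<and> det U = [:c:])"

definition is_inverse_mat :: "'a :: semiring_1 mat \<Rightarrow> 'a mat \<Rightarrow> bool" where
  "is_inverse_mat U V \<longleftrightarrow> inverts_mat U V \<and> inverts_mat V U"

text \<open>Only meaningful for vectors of positive dimension; the zero vector gets degree 0.\<close>

definition vec_degree :: "'a :: zero poly vec \<Rightarrow> nat" where
  "vec_degree v = (MAX i\<in>{..<dim_vec v}. degree (v $ i))"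

text \<open>\<open>poly_basis q W vs\<close>: the polynomial vectors \<open>vs\<close> form a basis, over the rational functions,
  of the subspace \<open>W\<close> of rational vectors of length \<open>q\<close>. Since bases are lists, \<open>distinct\<close> is
  part of linear independence.\<close>

definition poly_basis :: "nat \<Rightarrow> 'a :: field poly fract vec set \<Rightarrow> 'a poly vec list \<Rightarrow> bool" where
  "poly_basis q W vs \<longleftrightarrow>
     set vs \<subseteq> carrier_vec q \<and> distinct vs \<and>
     LinearCombinations.module.lin_indpt class_ring (module_vec TYPE('a poly fract) q)
       (map_vec to_fract ` set vs) \<and>
     LinearCombinations.module.span class_ring (module_vec TYPE('a poly fract) q)
       (map_vec to_fract ` set vs) = W"

definition minimal_poly_basis ::
    "nat \<Rightarrow> 'a :: field poly fract vec set \<Rightarrow> 'a poly vec list \<Rightarrow> bool" where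
  "minimal_poly_basis q W vs \<longleftrightarrow>
     poly_basis q W vs \<and>
     (\<forall>ws. poly_basis q W ws \<longrightarrow>
        sum_list (map vec_degree vs) \<le> sum_list (map vec_degree ws))"

definition minimal_basis :: "'a :: field poly mat \<Rightarrow> bool" where
  "minimal_basis K \<longleftrightarrow>
     dim_row K < dim_col K \<and>
     minimal_poly_basis (dim_col K)
       (vec_space.row_space (dim_col K) (map_mat to_fract K)) (rows K)"

definition dual_minimal_bases :: "'a :: field poly mat \<Rightarrow> 'a poly mat \<Rightarrow> bool" where
  "dual_minimal_bases K N \<longleftrightarrow>
     dim_col N = dim_col K \<and> dim_row K + dim_row N = dim_col K \<and>
     K * N\<^sup>T = 0\<^sub>m (dim_row K) (dim_row N) \<and>
     minimal_basis K \<and> minimal_basis N"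

text \<open>An absent \<open>K\<close> is a matrix with no rows; by convention its dual is the identity matrix.\<close>

definition dual_basis_or_identity :: "'a :: field poly mat \<Rightarrow> 'a poly mat \<Rightarrow> bool" where
  "dual_basis_or_identity K N \<longleftrightarrow>
     (if dim_row K = 0 then N = 1\<^sub>m (dim_col K) else dual_minimal_bases K N)"

text \<open>The row degrees of a minimal basis depend, up to order, only on the row space, so it does not
  matter which dual minimal basis \<open>N\<close> is taken in the following definition.\<close>

definition strong_minimal_block :: "nat \<Rightarrow> 'a :: field poly mat \<Rightarrow> bool" where
  "strong_minimal_block l K \<longleftrightarrow>
     minimal_basis K \<and>
     (\<forall>i < dim_row K. vec_degree (row K i) = l) \<and>
     (\<exists>N d. dual_minimal_bases K N \<and> (\<forall>i < dim_row N. vec_degree (row N i) = d))"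

definition strong_block_minimal_bases ::
    "nat \<Rightarrow> nat \<Rightarrow> nat \<Rightarrow> nat \<Rightarrow> nat \<Rightarrow> 'a :: field poly mat \<Rightarrow> 'a poly mat \<Rightarrow> 'a poly mat \<Rightarrow>
     'a poly mat \<Rightarrow> bool" where
  "strong_block_minimal_bases l m n m1 m2 M K1 K2 L \<longleftrightarrow>
     l > 0 \<and> (m1 > 0 \<or> m2 > 0) \<and>
     M \<in> carrier_mat (m + m2) (n + m1) \<and> has_grade l M \<and>
     K1 \<in> carrier_mat m1 (n + m1) \<and> (m1 > 0 \<longrightarrow> strong_minimal_block l K1) \<and>
     K2 \<in> carrier_mat m2 (m + m2) \<and> (m2 > 0 \<longrightarrow> strong_minimal_block l K2) \<and>
     L = four_block_mat M K2\<^sup>T K1 (0\<^sub>m m1 m2)"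

text \<open>\<open>K'\<close> and \<open>N'\<close> are the hatted matrices. If \<open>K\<close> has no rows and \<open>N\<close> is the identity matrix,
  then \<open>N'\<close> has no rows and the last condition says that \<open>K'\<close> is the identity matrix.\<close>

definition unimodular_embedding ::
    "'a :: field poly mat \<Rightarrow> 'a poly mat \<Rightarrow> 'a poly mat \<Rightarrow> 'a poly mat \<Rightarrow> bool" where
  "unimodular_embedding K K' N N' \<longleftrightarrow>
     K' \<in> carrier_mat (dim_row N) (dim_col K) \<and>
     N' \<in> carrier_mat (dim_row K) (dim_col N) \<and>
     unimodular (K @\<^sub>r K') \<and>
     is_inverse_mat (K @\<^sub>r K') (N'\<^sup>T @\<^sub>c N\<^sup>T)"

end

theory Submission
  imports Defs
begin

text \<open>Multiplying \<open>L\<close> out blockwise, the right-sided factorization comes down to two facts. The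
  block row \<open>K1\<close> is annihilated by \<open>N1\<^sup>T\<close>, because the two bases are dual. In the first block row,
  \<open>M * N1\<^sup>T\<close> stands to the right of \<open>1 - K2\<^sup>T * N2h\<close>, and this factor is \<open>K2h\<^sup>T * N2\<close>: the product
  of the inverse of the unimodular matrix \<open>U2\<close> with \<open>U2\<close>, in this order, splits the identity as
  \<open>N2h\<^sup>T * K2 + N2\<^sup>T * K2h\<close>. So the first block row is \<open>K2h\<^sup>T * Q\<close>.

  The left-sided factorization is the same statement for \<open>L\<^sup>T\<close>, in which \<open>M\<close> is transposed and the
  indices 1 and 2 are exchanged.\<close>

lemma transpose_append_cols:
  assumes "A \<in> carrier_mat r p" "B \<in> carrier_mat r q"
  shows "(A @\<^sub>c B)\<^sup>T = A\<^sup>T @\<^sub>r B\<^sup>T"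
  unfolding append_cols_def append_rows_def
  by (rule eq_matI) (use assms in auto)

lemma append_cols_mult_append_rows:
  fixes A :: "'a :: comm_ring_1 mat"
  assumes "A \<in> carrier_mat r p" "B \<in> carrier_mat r q"
    and "C \<in> carrier_mat p s" "D \<in> carrier_mat q s"
  shows "(A @\<^sub>c B) * (C @\<^sub>r D) = A * C + B * D"
proof -
  have "four_block_mat A B (0\<^sub>m 0 p) (0\<^sub>m 0 q) * four_block_mat C (0\<^sub>m p 0) D (0\<^sub>m q 0) =
      four_block_mat (A * C + B * D) (A * 0\<^sub>m p 0 + B * 0\<^sub>m q 0)
        (0\<^sub>m 0 p * C + 0\<^sub>m 0 q * D) (0\<^sub>m 0 p * 0\<^sub>m p 0 + 0\<^sub>m 0 q * 0\<^sub>m q 0)"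
    by (rule mult_four_block_mat) (use assms in auto)
  also have "\<dots> = A * C + B * D"
    by (rule eq_matI) (use assms in auto)
  finally show ?thesis
    using assms by (simp add: append_cols_def append_rows_def)
qed

lemma append_rows_mult:
  fixes A :: "'a :: comm_ring_1 mat"
  assumes "A \<in> carrier_mat p r" "B \<in> carrier_mat q r" "C \<in> carrier_mat r s"
  shows "(A @\<^sub>r B) * C = A * C @\<^sub>r B * C"
proof -
  have "four_block_mat A (0\<^sub>m p 0) B (0\<^sub>m q 0) * four_block_mat C (0\<^sub>m r 0) (0\<^sub>m 0 s) (0\<^sub>m 0 0) =
      four_block_mat (A * C + 0\<^sub>m p 0 * 0\<^sub>m 0 s) (A * 0\<^sub>m r 0 + 0\<^sub>m p 0 * 0\<^sub>m 0 0)
        (B * C + 0\<^sub>m q 0 * 0\<^sub>m 0 s) (B * 0\<^sub>m r 0 + 0\<^sub>m q 0 * 0\<^sub>m 0 0)"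
    by (rule mult_four_block_mat) (use assms in auto)
  also have "\<dots> = A * C @\<^sub>r B * C"
    unfolding append_rows_def by (rule eq_matI) (use assms in auto)
  also have "four_block_mat C (0\<^sub>m r 0) (0\<^sub>m 0 s) (0\<^sub>m 0 0) = C"
    by (rule eq_matI) (use assms in auto)
  finally show ?thesis
    using assms by (simp add: append_rows_def)
qed

lemma four_block_mat_mult_append_rows:
  fixes A :: "'a :: comm_ring_1 mat"
  assumes "A \<in> carrier_mat p r" "B \<in> carrier_mat p s"
    and "C \<in> carrier_mat q r" "D \<in> carrier_mat q s"
    and "X \<in> carrier_mat r t" "Y \<in> carrier_mat s t"
  shows "four_block_mat A B C D * (X @\<^sub>r Y) = (A * X + B * Y) @\<^sub>r (C * X + D * Y)"
proof -
  have "four_block_mat A B C D * four_block_mat X (0\<^sub>m r 0) Y (0\<^sub>m s 0) =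
      four_block_mat (A * X + B * Y) (A * 0\<^sub>m r 0 + B * 0\<^sub>m s 0)
        (C * X + D * Y) (C * 0\<^sub>m r 0 + D * 0\<^sub>m s 0)"
    by (rule mult_four_block_mat) (use assms in auto)
  also have "\<dots> = (A * X + B * Y) @\<^sub>r (C * X + D * Y)"
    unfolding append_rows_def by (rule eq_matI) (use assms in auto)
  finally show ?thesis
    using assms by (simp add: append_rows_def)
qed

text \<open>The conventions for an absent block make the sizes and the relation \<open>K * N\<^sup>T = 0\<close> hold in
  the degenerate case too, so that no later argument has to single it out.\<close>

lemma dual_basis_or_identityD:
  assumes "dual_basis_or_identity K N" and "K \<in> carrier_mat k (r + k)"
  shows "N \<in> carrier_mat r (r + k)" and "K * N\<^sup>T = 0\<^sub>m k r"
proof -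
  have "N \<in> carrier_mat r (r + k) \<and> K * N\<^sup>T = 0\<^sub>m k r"
  proof (cases "k = 0")
    case True
    with assms have "N = 1\<^sub>m r" "K \<in> carrier_mat 0 r"
      by (auto simp: dual_basis_or_identity_def)
    then show ?thesis
      using True by (auto intro!: eq_matI)
  next
    case False
    with assms have "dim_col N = r + k" "k + dim_row N = r + k" "K * N\<^sup>T = 0\<^sub>m k (dim_row N)"
      by (auto simp: dual_basis_or_identity_def dual_minimal_bases_def)
    then show ?thesis
      by auto
  qed
  then show "N \<in> carrier_mat r (r + k)" and "K * N\<^sup>T = 0\<^sub>m k r"
    by blast+
qed

text \<open>The identity is a product \<open>U\<^sup>-\<^sup>1 * U\<close>, written out in blocks and then transposed.\<close>

lemma unimodular_embedding_resolution_of_identity: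
  assumes "unimodular_embedding K K' N N'"
    and "K \<in> carrier_mat k (r + k)" and "N \<in> carrier_mat r (r + k)"
  shows "K\<^sup>T * N' + K'\<^sup>T * N = 1\<^sub>m (r + k)"
proof -
  have K': "K' \<in> carrier_mat r (r + k)" and N': "N' \<in> carrier_mat k (r + k)"
    and inv: "(N'\<^sup>T @\<^sub>c N\<^sup>T) * (K @\<^sub>r K') = 1\<^sub>m (dim_row (N'\<^sup>T @\<^sub>c N\<^sup>T))"
    using assms by (auto simp: unimodular_embedding_def is_inverse_mat_def inverts_mat_def)
  have "dim_row (N'\<^sup>T @\<^sub>c N\<^sup>T) = r + k"
    using N' by (simp add: append_cols_def)
  moreover have "(N'\<^sup>T @\<^sub>c N\<^sup>T) * (K @\<^sub>r K') = N'\<^sup>T * K + N\<^sup>T * K'"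
    by (rule append_cols_mult_append_rows) (use assms K' N' in auto)
  ultimately have "N'\<^sup>T * K + N\<^sup>T * K' = 1\<^sub>m (r + k)"
    using inv by simp
  then have "(N'\<^sup>T * K + N\<^sup>T * K')\<^sup>T = 1\<^sub>m (r + k)"
    by simp
  moreover have "(N'\<^sup>T * K + N\<^sup>T * K')\<^sup>T = (N'\<^sup>T * K)\<^sup>T + (N\<^sup>T * K')\<^sup>T"
    by (rule transpose_add) (use assms K' N' in auto)
  moreover have "(N'\<^sup>T * K)\<^sup>T = K\<^sup>T * N'"
    using transpose_mult[of "N'\<^sup>T" "r + k" k K "r + k"] assms N' by simp
  moreover have "(N\<^sup>T * K')\<^sup>T = K'\<^sup>T * N"
    using transpose_mult[of "N\<^sup>T" "r + k" r K' "r + k"] assms K' by simp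
  ultimately show ?thesis
    by simp
qed

text \<open>The bottom block vanishes by duality, and the top block is the split identity multiplied
  from the right by \<open>M * N1\<^sup>T\<close>. The statement treats the blocks symmetrically enough to apply to
  both \<open>L\<close> and \<open>L\<^sup>T\<close>, which gives the two factorizations.\<close>

lemma block_right_factorization:
  fixes M :: "'a :: comm_ring_1 mat"
  assumes M: "M \<in> carrier_mat (m + m2) (n + m1)"
    and K1: "K1 \<in> carrier_mat m1 (n + m1)" and N1: "N1 \<in> carrier_mat n (n + m1)"
    and K2: "K2 \<in> carrier_mat m2 (m + m2)" and N2: "N2 \<in> carrier_mat m (m + m2)"
    and K2h: "K2h \<in> carrier_mat m (m + m2)" and N2h: "N2h \<in> carrier_mat m2 (m + m2)"
    and dual: "K1 * N1\<^sup>T = 0\<^sub>m m1 n"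
    and split: "K2\<^sup>T * N2h + K2h\<^sup>T * N2 = 1\<^sub>m (m + m2)"
  shows "four_block_mat M K2\<^sup>T K1 (0\<^sub>m m1 m2) * (N1\<^sup>T @\<^sub>r (- (N2h * M * N1\<^sup>T))) =
         (K2h\<^sup>T @\<^sub>r 0\<^sub>m m1 m) * (N2 * M * N1\<^sup>T)"
proof -
  define X where "X = M * N1\<^sup>T"
  have X: "X \<in> carrier_mat (m + m2) n"
    using M N1 by (auto simp: X_def)
  have N2hX: "N2h * M * N1\<^sup>T = N2h * X" and N2X: "N2 * M * N1\<^sup>T = N2 * X"
    unfolding X_def by (rule assoc_mult_mat; use M N1 N2 N2h in auto)+
  have "X = (K2\<^sup>T * N2h + K2h\<^sup>T * N2) * X"
    using X by (simp add: split)
  also have "\<dots> = K2\<^sup>T * N2h * X + K2h\<^sup>T * N2 * X"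
    by (rule add_mult_distrib_mat) (use X K2 K2h N2 N2h in auto)
  also have "K2\<^sup>T * N2h * X = K2\<^sup>T * (N2h * X)"
    by (rule assoc_mult_mat) (use X K2 N2h in auto)
  also have "K2h\<^sup>T * N2 * X = K2h\<^sup>T * (N2 * X)"
    by (rule assoc_mult_mat) (use X K2h N2 in auto)
  finally have split_X: "X = K2\<^sup>T * (N2h * X) + K2h\<^sup>T * (N2 * X)" .
  have "X + K2\<^sup>T * (- (N2h * X)) = X + - (K2\<^sup>T * (N2h * X))"
    using K2 N2h X by simp
  also have "\<dots> = K2\<^sup>T * (N2h * X) + K2h\<^sup>T * (N2 * X) + - (K2\<^sup>T * (N2h * X))"
    by (subst split_X) (rule refl)
  also have "\<dots> = K2h\<^sup>T * (N2 * X)"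
    by (rule eq_matI) (use X K2 K2h N2 N2h in auto)
  finally have top: "M * N1\<^sup>T + K2\<^sup>T * (- (N2h * X)) = K2h\<^sup>T * (N2 * X)"
    by (simp add: X_def)
  have bottom: "K1 * N1\<^sup>T + 0\<^sub>m m1 m2 * (- (N2h * X)) = 0\<^sub>m m1 m * (N2 * X)"
    unfolding dual by (rule eq_matI) (use X N2 N2h in auto)
  have "four_block_mat M K2\<^sup>T K1 (0\<^sub>m m1 m2) * (N1\<^sup>T @\<^sub>r (- (N2h * X))) =
      (M * N1\<^sup>T + K2\<^sup>T * (- (N2h * X))) @\<^sub>r (K1 * N1\<^sup>T + 0\<^sub>m m1 m2 * (- (N2h * X)))"
    by (rule four_block_mat_mult_append_rows) (use M K1 N1 K2 N2h X in auto)
  also have "\<dots> = (K2h\<^sup>T @\<^sub>r 0\<^sub>m m1 m) * (N2 * X)"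
    unfolding top bottom
    by (rule append_rows_mult[symmetric]) (use K2h N2 X in auto)
  finally show ?thesis
    unfolding N2hX N2X .
qed

theorem theorem6p11:
  fixes L M K1 K2 N1 N2 K1h K2h N1h N2h Q :: "'a :: field poly mat"
    and l m n m1 m2 :: nat
  assumes "strong_block_minimal_bases l m n m1 m2 M K1 K2 L"
    and "dual_basis_or_identity K1 N1"
    and "dual_basis_or_identity K2 N2"
    and "Q = N2 * M * N1\<^sup>T"
    and "unimodular_embedding K1 K1h N1 N1h"
    and "unimodular_embedding K2 K2h N2 N2h"
  shows "L * (N1\<^sup>T @\<^sub>r (- (N2h * M * N1\<^sup>T))) = (K2h\<^sup>T @\<^sub>r 0\<^sub>m m1 m) * Q \<and>
         (N2 @\<^sub>c (- (N2 * M * N1h\<^sup>T))) * L = Q * (K1h @\<^sub>c 0\<^sub>m n m2)"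
proof
  have M: "M \<in> carrier_mat (m + m2) (n + m1)"
    and K1: "K1 \<in> carrier_mat m1 (n + m1)" and K2: "K2 \<in> carrier_mat m2 (m + m2)"
    and L: "L = four_block_mat M K2\<^sup>T K1 (0\<^sub>m m1 m2)"
    using assms(1) by (auto simp: strong_block_minimal_bases_def)
  note N1 = dual_basis_or_identityD(1)[OF assms(2) K1]
    and dual1 = dual_basis_or_identityD(2)[OF assms(2) K1]
    and N2 = dual_basis_or_identityD(1)[OF assms(3) K2]
    and dual2 = dual_basis_or_identityD(2)[OF assms(3) K2]
  note split1 = unimodular_embedding_resolution_of_identity[OF assms(5) K1 N1]
    and split2 = unimodular_embedding_resolution_of_identity[OF assms(6) K2 N2]
  have K1h: "K1h \<in> carrier_mat n (n + m1)" and N1h: "N1h \<in> carrier_mat m1 (n + m1)"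
    and K2h: "K2h \<in> carrier_mat m (m + m2)" and N2h: "N2h \<in> carrier_mat m2 (m + m2)"
    using assms(5,6) K1 N1 K2 N2 by (auto simp: unimodular_embedding_def)
  have Q: "Q \<in> carrier_mat m n"
    using assms(4) M N1 N2 by auto
  show "L * (N1\<^sup>T @\<^sub>r (- (N2h * M * N1\<^sup>T))) = (K2h\<^sup>T @\<^sub>r 0\<^sub>m m1 m) * Q"
    unfolding L assms(4)
    by (rule block_right_factorization[OF M K1 N1 K2 N2 K2h N2h dual1 split2])
  \<comment> \<open>The left-sided factorization is the previous one for \<open>L\<^sup>T\<close>, so the remaining steps translate
    each factor into its transpose.\<close>
  have transpose_prod: "(N2 * M * Y\<^sup>T)\<^sup>T = Y * M\<^sup>T * N2\<^sup>T" if Y: "Y \<in> carrier_mat k (n + m1)" for Y k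
  proof -
    have "(N2 * M * Y\<^sup>T)\<^sup>T = Y\<^sup>T\<^sup>T * (N2 * M)\<^sup>T"
      by (rule transpose_mult) (use M N2 Y in auto)
    also have "(N2 * M)\<^sup>T = M\<^sup>T * N2\<^sup>T"
      using N2 M by (rule transpose_mult)
    also have "Y\<^sup>T\<^sup>T * (M\<^sup>T * N2\<^sup>T) = Y * M\<^sup>T * N2\<^sup>T"
      using assoc_mult_mat[of Y k "n + m1" "M\<^sup>T" "m + m2" "N2\<^sup>T" m] M N2 Y by simp
    finally show ?thesis .
  qed
  have LT: "L\<^sup>T = four_block_mat M\<^sup>T K1\<^sup>T K2 (0\<^sub>m m2 m1)"
    unfolding L using transpose_four_block_mat[of M _ _ "K2\<^sup>T" _ K1 _ "0\<^sub>m m1 m2"] M K1 K2 by simp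
  have prod: "N2 * M * N1h\<^sup>T \<in> carrier_mat m m1"
    using N2 M N1h by auto
  have R: "N2 @\<^sub>c (- (N2 * M * N1h\<^sup>T)) \<in> carrier_mat m ((m + m2) + m1)"
    using N2 N1h by (auto simp: append_cols_def)
  have S: "K1h @\<^sub>c 0\<^sub>m n m2 \<in> carrier_mat n ((n + m1) + m2)"
    using K1h by (auto simp: append_cols_def)
  have "((N2 @\<^sub>c (- (N2 * M * N1h\<^sup>T))) * L)\<^sup>T = L\<^sup>T * (N2 @\<^sub>c (- (N2 * M * N1h\<^sup>T)))\<^sup>T"
    by (rule transpose_mult[OF R]) (use L M K1 K2 in auto)
  also have "(N2 @\<^sub>c (- (N2 * M * N1h\<^sup>T)))\<^sup>T = N2\<^sup>T @\<^sub>r (- (N1h * M\<^sup>T * N2\<^sup>T))"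
    using transpose_append_cols[OF N2, of "- (N2 * M * N1h\<^sup>T)" m1] prod N1h
    by (simp add: transpose_uminus transpose_prod)
  also have "L\<^sup>T * \<dots> = (K1h\<^sup>T @\<^sub>r 0\<^sub>m m2 n) * (N1 * M\<^sup>T * N2\<^sup>T)"
    unfolding LT
    by (rule block_right_factorization[OF _ K2 N2 K1 N1 K1h N1h dual2 split1]) (use M in simp)
  also have "K1h\<^sup>T @\<^sub>r 0\<^sub>m m2 n = (K1h @\<^sub>c 0\<^sub>m n m2)\<^sup>T"
    using transpose_append_cols[OF K1h, of "0\<^sub>m n m2" m2] by simp
  also have "N1 * M\<^sup>T * N2\<^sup>T = Q\<^sup>T"
    unfolding assms(4) using transpose_prod[OF N1] by simp
  also have "(K1h @\<^sub>c 0\<^sub>m n m2)\<^sup>T * Q\<^sup>T = (Q * (K1h @\<^sub>c 0\<^sub>m n m2))\<^sup>T"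
    by (rule transpose_mult[OF Q S, symmetric])
  finally show "(N2 @\<^sub>c (- (N2 * M * N1h\<^sup>T))) * L = Q * (K1h @\<^sub>c 0\<^sub>m n m2)"
    by simp
qed

end
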